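(* Let $\{\mu_t\}_{t\in[0,T]}$ be the limit family from the definition of approximative solutions below, with $\rho_t$ its $x$-marginal and $M$ the uniform velocity bound. Then $\{\mu_t\}$ is locally mass preserving: for every set $C\subset\mathbb{R}^d$ and all $0\le t_0\le t\le T$, $$\rho_t\big(\overline{C}+(t-t_0)\overline{B(M)}\big)\ge\rho_{t_0}(C).$$
   Context: Setting: $T>0$, $\alpha\in[1,2]$, $d\ge1$, $\psi(s)=s^{-\alpha}$; $\overline{S}$ denotes closure and $+$ the Minkowski sum. Particle system: $\dot x_i=v_i$, $\dot v_i=\frac1N\sum_{j\ne i}\psi(|x_i-x_j|)(v_j-v_i)$ (unique smooth non-collisional global solutions for distinct initial positions). Atomic solution: $\mu^N_t=\frac1N\sum_i\delta_{x_i^N(t)}\otimes\delta_{v_i^N(t)}$, $\mu^N=\mu^N_t\otimes\lambda^1(t)$, where $\mu=\mu_t\otimes\lambda^1(t)$ means $\int g\,d\mu=\int_0^T\int g(t,\cdot)d\mu_t\,dt$. $E[\mu_t]=\int|v|^2d\mu_t$. Approximative solutions: given compactly supported $\rho_0\in\mathcal{P}(\mathbb{R}^d)$ and $u_0\in L^\infty(\rho_0;\mathbb{R}^d)$, for each $N$ take initial data $(x_{i0}^N,v_{i0}^N)_{i=1}^N$ with pairwise distinct $x_{i0}^N$ such that $\frac1N\sum_i\delta_{x_{i0}^N}\rightharpoonup\rho_0$ and $\frac1N\sum_iv_{i0}^N\delta_{x_{i0}^N}\rightharpoonup u_0\rho_0$ narrowly, with all $\mu^N_t$ supported in $(T+1)B(M)\times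 B(M)$ for a fixed $M$ (so $|v_i^N(t)|<M$); let $\mu^N$ be the associated atomic solutions, and pass to a subsequence (not relabeled) such that: $\mu^N\rightharpoonup\mu=\mu_t\otimes\lambda^1(t)$ narrowly; $[\mu^N_t\otimes\mu^N_t]\otimes\lambda^1(t)\rightharpoonup[\mu_t\otimes\mu_t]\otimes\lambda^1(t)$ narrowly; $\rho^N_t:=\int_{\mathbb{R}^d_v}d\mu^N_t\to\rho_t$ in $C([0,T];(\mathcal{M}_+(\mathbb{R}^d),d_{BL}))$, where $\rho_t$ is the $x$-marginal of $\mu_t$; and $E[\mu^N_t]\to E[\mu_t]$ for all $t$ in a full-measure set $A_E$. $B(r)$ is the open ball of radius $r$ at $0$ and $d_{BL}$ the bounded-Lipschitz distance. *)

theory Defs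
  imports "HOL-Probability.Probability"
begin

text \<open>Communication weight psi(s) = s^(-alpha).\<close>
definition psi :: "real \<Rightarrow> real \<Rightarrow> real" where
  "psi \<alpha> s = s powr (- \<alpha>)"

text \<open>(x,v) is the (unique, smooth, non-collisional) solution of the N-particle
  Cucker--Smale system on [0,T]: particles indexed by i < N.\<close>
definition particle_sol ::
  "real \<Rightarrow> real \<Rightarrow> nat \<Rightarrow> (nat \<Rightarrow> real \<Rightarrow> 'a::euclidean_space) \<Rightarrow> (nat \<Rightarrow> real \<Rightarrow> 'a) \<Rightarrow> bool" where
  "particle_sol \<alpha> T N x v \<longleftrightarrow>
     (\<forall>t\<in>{0..T}.
        (\<forall>i<N. \<forall>j<N. i \<noteq> j \<longrightarrow> x i t \<noteq> x j t) \<and>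
        (\<forall>i<N. (x i has_vector_derivative v i t) (at t within {0..T}) \<and>
               (v i has_vector_derivative
                  ((1 / real N) *\<^sub>R (\<Sum>j\<in>{..<N} - {i}. psi \<alpha> (norm (x i t - x j t)) *\<^sub>R (v j t - v i t))))
                 (at t within {0..T})))"

text \<open>Bounded continuous test functions (narrow convergence).\<close>
definition bcont :: "('b::topological_space \<Rightarrow> real) \<Rightarrow> bool" where
  "bcont g \<longleftrightarrow> continuous_on UNIV g \<and> bounded (range g)"

text \<open>Test functions in the unit ball of the bounded-Lipschitz norm (defining d_BL).\<close>
definition BL1 :: "('b::metric_space \<Rightarrow> real) \<Rightarrow> bool" where
  "BL1 f \<longleftrightarrow> (\<forall>y. \<bar>f y\<bar> \<le> 1) \<and> (\<forall>y z. \<bar>f y - f z\<bar> \<le> dist y z)"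

text \<open>x-marginal of a measure on R^d x R^d.\<close>
definition xmarg :: "('a::euclidean_space \<times> 'a) measure \<Rightarrow> 'a measure" where
  "xmarg m = distr m borel fst"

text \<open>Kinetic energy E[mu_t].\<close>
definition energy :: "('a::euclidean_space \<times> 'a) measure \<Rightarrow> real" where
  "energy m = integral\<^sup>L m (\<lambda>z. (norm (snd z))\<^sup>2)"

end

theory Submission
  imports Defs
begin

text \<open>Over [t0, t] each particle moves by a vector of length at most (t - t0) M, so the
  translate of F = closure C by any particle's displacement lies in G = F + (t - t0) cball 0 M,
  and the 1-Lipschitz cutoffs h_A = max 0 (e - infdist _ A) satisfy h_F(x_i(t0)) <= h_G(x_i(t)).
  Averaging over the particles and passing to the d_BL limit gives
  e rho_t0(F) <= int h_F d rho_t0 <= int h_G d rho_t <= e rho_t {y. infdist y G < e},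
  and as e tends to 0 these open thickenings decrease to the closed set G.\<close>

definition infdist_cutoff :: "'a::metric_space set \<Rightarrow> real \<Rightarrow> 'a \<Rightarrow> real" where
  "infdist_cutoff A e y = max 0 (e - infdist y A)"

definition empirical_BL_conv ::
  "(nat \<Rightarrow> nat) \<Rightarrow> (nat \<Rightarrow> nat \<Rightarrow> 'a::metric_space) \<Rightarrow> 'a measure \<Rightarrow> bool" where
  "empirical_BL_conv N X \<rho> \<longleftrightarrow>
     (\<forall>\<epsilon>>0. \<forall>\<^sub>F k in sequentially. \<forall>f. BL1 f \<longrightarrow>
        \<bar>(1 / real (N k)) * (\<Sum>i<N k. f (X k i)) - integral\<^sup>L \<rho> f\<bar> \<le> \<epsilon>)"

lemma infdist_translate_le:
  fixes F G :: "'a::{real_normed_vector, heine_borel} set"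
  assumes "closed F" "F \<noteq> {}" and moves: "\<And>z. z \<in> F \<Longrightarrow> z + d \<in> G"
  shows "infdist (y + d) G \<le> infdist y F"
proof -
  obtain z where z: "z \<in> F" "infdist y F = dist y z"
    using infdist_attains_inf[OF assms(1,2)] by blast
  have "infdist (y + d) G \<le> dist (y + d) (z + d)"
    by (rule infdist_le[OF moves[OF z(1)]])
  then show ?thesis
    using z by (simp add: dist_norm)
qed

lemma BL1_infdist_cutoff:
  assumes "e \<le> 1"
  shows "BL1 (infdist_cutoff A e)"
  unfolding BL1_def infdist_cutoff_def
proof safe
  fix y show "\<bar>max 0 (e - infdist y A)\<bar> \<le> 1"
    using assms infdist_nonneg[of y A] by auto
next
  fix y z show "\<bar>max 0 (e - infdist y A) - max 0 (e - infdist z A)\<bar> \<le> dist y z"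
    using infdist_triangle_abs[of y A z] by (auto simp: abs_if split: if_splits)
qed

lemma integrable_infdist_cutoff:
  assumes "finite_measure m" "sets m = sets borel"
  shows "integrable m (infdist_cutoff A e)"
proof (rule finite_measure.integrable_const_bound[OF assms(1), where B="\<bar>e\<bar>"])
  show "infdist_cutoff A e \<in> borel_measurable m"
    unfolding measurable_cong_sets[OF assms(2) refl] infdist_cutoff_def
    by (intro borel_measurable_continuous_onI continuous_intros)
  show "AE y in m. norm (infdist_cutoff A e y) \<le> \<bar>e\<bar>"
  proof (rule AE_I2)
    fix y show "norm (infdist_cutoff A e y) \<le> \<bar>e\<bar>"
      using infdist_nonneg[of y A] by (auto simp: infdist_cutoff_def)
  qed
qed

lemma measure_le_integral_infdist_cutoff:
  assumes m: "finite_measure m" "sets m = sets borel" and "A \<in> sets borel" "0 \<le> e"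
  shows "e * measure m A \<le> integral\<^sup>L m (infdist_cutoff A e)"
proof -
  have A: "A \<in> sets m" "emeasure m A < \<infinity>"
    using assms finite_measure.emeasure_finite[OF m(1)] by (auto simp: top.not_eq_extremum[symmetric])
  have "e * measure m A = integral\<^sup>L m (\<lambda>y. e * indicator A y)"
    using A by simp
  also have "\<dots> \<le> integral\<^sup>L m (infdist_cutoff A e)"
    using A \<open>0 \<le> e\<close> integrable_infdist_cutoff[OF m]
    by (intro integral_mono integrable_mult_right integrable_real_indicator)
       (auto simp: infdist_cutoff_def indicator_def infdist_nonneg)
  finally show ?thesis .
qed

lemma integral_infdist_cutoff_le_measure:
  assumes m: "finite_measure m" "sets m = sets borel" and "0 \<le> e"
  shows "integral\<^sup>L m (infdist_cutoff A e) \<le> e * measure m {y. infdist y A < e}"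
proof -
  have "open {y. infdist y A < e}"
    by (intro open_Collect_less continuous_intros)
  then have U: "{y. infdist y A < e} \<in> sets m" "emeasure m {y. infdist y A < e} < \<infinity>"
    using m finite_measure.emeasure_finite[OF m(1)] by (auto simp: top.not_eq_extremum[symmetric])
  have "integral\<^sup>L m (infdist_cutoff A e) \<le> integral\<^sup>L m (\<lambda>y. e * indicator {y. infdist y A < e} y)"
    using U \<open>0 \<le> e\<close> integrable_infdist_cutoff[OF m]
    by (intro integral_mono integrable_mult_right integrable_real_indicator)
       (auto simp: infdist_cutoff_def indicator_def infdist_nonneg)
  also have "\<dots> = e * measure m {y. infdist y A < e}"
    using U by simp
  finally show ?thesis .
qed

lemma Inter_infdist_thickenings:
  fixes G :: "'a::metric_space set"
  assumes "closed G" "G \<noteq> {}"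
  shows "(\<Inter>n. {y. infdist y G < 1 / Suc n}) = G"
proof safe
  fix y assume y: "y \<in> (\<Inter>n. {y. infdist y G < 1 / Suc n})"
  have "infdist y G = 0"
  proof (rule ccontr)
    assume "infdist y G \<noteq> 0"
    then have "0 < infdist y G"
      using infdist_nonneg[of y G] by simp
    then obtain n where "1 / Suc n < infdist y G"
      by (rule nat_approx_posE)
    moreover have "infdist y G < 1 / Suc n"
      using y by blast
    ultimately show False
      by simp
  qed
  then show "y \<in> G"
    using in_closed_iff_infdist_zero[OF assms] by simp
qed auto

lemma le_measure_closed_of_thickenings:
  assumes m: "finite_measure m" "sets m = sets borel" and G: "closed G" "G \<noteq> {}"
    and le: "\<And>e. 0 < e \<Longrightarrow> e \<le> 1 \<Longrightarrow> a \<le> measure m {y. infdist y G < e}"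
  shows "a \<le> measure m G"
proof -
  let ?U = "\<lambda>n::nat. {y. infdist y G < 1 / Suc n}"
  have "(\<lambda>n. measure m (?U n)) \<longlonglongrightarrow> measure m (\<Inter>n. ?U n)"
  proof (rule finite_measure.finite_Lim_measure_decseq[OF m(1)])
    have "open (?U n)" for n
      by (intro open_Collect_less continuous_intros)
    then show "range ?U \<subseteq> sets m"
      using m(2) by auto
    show "decseq ?U"
    proof (rule decseq_SucI)
      fix n :: nat
      have "1 / real (Suc (Suc n)) \<le> 1 / real (Suc n)"
        by (intro divide_left_mono) auto
      then show "?U (Suc n) \<subseteq> ?U n"
        by auto
    qed
  qed
  then have lim: "(\<lambda>n. measure m (?U n)) \<longlonglongrightarrow> measure m G"
    by (simp only: Inter_infdist_thickenings[OF G])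
  have "a \<le> measure m (?U n)" for n
    by (rule le) (simp_all add: divide_simps)
  then show ?thesis
    using LIMSEQ_le_const[OF lim] by blast
qed

lemma empirical_BL_conv_integral_mono:
  assumes X: "empirical_BL_conv N X \<rho>" and Y: "empirical_BL_conv N Y \<sigma>"
    and "BL1 f" "BL1 g" and le: "\<And>k i. i < N k \<Longrightarrow> f (X k i) \<le> g (Y k i)"
  shows "integral\<^sup>L \<rho> f \<le> integral\<^sup>L \<sigma> g"
proof (rule field_le_epsilon)
  fix d :: real assume "0 < d"
  then have "\<forall>\<^sub>F k in sequentially.
      (\<forall>h. BL1 h \<longrightarrow> \<bar>(1 / real (N k)) * (\<Sum>i<N k. h (X k i)) - integral\<^sup>L \<rho> h\<bar> \<le> d / 2) \<and>
      (\<forall>h. BL1 h \<longrightarrow> \<bar>(1 / real (N k)) * (\<Sum>i<N k. h (Y k i)) - integral\<^sup>L \<sigma> h\<bar> \<le> d / 2)"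
    using X[unfolded empirical_BL_conv_def, rule_format, of "d / 2"]
      Y[unfolded empirical_BL_conv_def, rule_format, of "d / 2"]
    by (intro eventually_conj) simp_all
  then obtain k where
      "\<forall>h. BL1 h \<longrightarrow> \<bar>(1 / real (N k)) * (\<Sum>i<N k. h (X k i)) - integral\<^sup>L \<rho> h\<bar> \<le> d / 2"
      "\<forall>h. BL1 h \<longrightarrow> \<bar>(1 / real (N k)) * (\<Sum>i<N k. h (Y k i)) - integral\<^sup>L \<sigma> h\<bar> \<le> d / 2"
    unfolding eventually_sequentially by blast
  with \<open>BL1 f\<close> \<open>BL1 g\<close> have k:
      "\<bar>(1 / real (N k)) * (\<Sum>i<N k. f (X k i)) - integral\<^sup>L \<rho> f\<bar> \<le> d / 2"
      "\<bar>(1 / real (N k)) * (\<Sum>i<N k. g (Y k i)) - integral\<^sup>L \<sigma> g\<bar> \<le> d / 2"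
    by blast+
  have "(1 / real (N k)) * (\<Sum>i<N k. f (X k i)) \<le> (1 / real (N k)) * (\<Sum>i<N k. g (Y k i))"
    using le by (intro mult_left_mono sum_mono) auto
  with k show "integral\<^sup>L \<rho> f \<le> integral\<^sup>L \<sigma> g + d"
    by linarith
qed

lemma empirical_BL_conv_measure_transport:
  fixes X Y :: "nat \<Rightarrow> nat \<Rightarrow> 'a::euclidean_space"
  assumes \<rho>: "finite_measure \<rho>" "sets \<rho> = sets borel" and \<sigma>: "finite_measure \<sigma>" "sets \<sigma> = sets borel"
    and X: "empirical_BL_conv N X \<rho>" and Y: "empirical_BL_conv N Y \<sigma>"
    and F: "closed F" and G: "closed G" "G \<noteq> {}"
    and moves: "\<And>z k i. z \<in> F \<Longrightarrow> i < N k \<Longrightarrow> z + (Y k i - X k i) \<in> G"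
  shows "measure \<rho> F \<le> measure \<sigma> G"
proof (cases "F = {}")
  case False
  show ?thesis
  proof (rule le_measure_closed_of_thickenings[OF \<sigma> G])
    fix e :: real assume e: "0 < e" "e \<le> 1"
    have "infdist_cutoff F e (X k i) \<le> infdist_cutoff G e (Y k i)" if "i < N k" for k i
      using infdist_translate_le[OF F False moves[OF _ that], of "X k i"]
      by (simp add: infdist_cutoff_def)
    then have "integral\<^sup>L \<rho> (infdist_cutoff F e) \<le> integral\<^sup>L \<sigma> (infdist_cutoff G e)"
      using e by (intro empirical_BL_conv_integral_mono[OF X Y] BL1_infdist_cutoff)
    moreover have "e * measure \<rho> F \<le> integral\<^sup>L \<rho> (infdist_cutoff F e)"
      using e by (intro measure_le_integral_infdist_cutoff[OF \<rho>] borel_closed F) simp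
    moreover have "integral\<^sup>L \<sigma> (infdist_cutoff G e) \<le> e * measure \<sigma> {y. infdist y G < e}"
      using e by (intro integral_infdist_cutoff_le_measure[OF \<sigma>]) simp
    ultimately have "e * measure \<rho> F \<le> e * measure \<sigma> {y. infdist y G < e}"
      by linarith
    then show "measure \<rho> F \<le> measure \<sigma> {y. infdist y G < e}"
      using e by simp
  qed
qed simp

lemma displacement_in_scaled_cball:
  fixes f f' :: "real \<Rightarrow> 'a::real_normed_vector"
  assumes deriv: "\<And>s. s \<in> {a..b} \<Longrightarrow> (f has_vector_derivative f' s) (at s within {a..b})"
    and bound: "\<And>s. s \<in> {a..b} \<Longrightarrow> norm (f' s) \<le> M"
    and "a \<le> t0" "t0 \<le> t" "t \<le> b"
  shows "f t - f t0 \<in> (*\<^sub>R) (t - t0) ` cball 0 M"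
proof (cases "t = t0")
  case True
  have "0 \<le> M"
    using bound[of t] assms(3-5) norm_ge_zero[of "f' t"] by (meson atLeastAtMost_iff order_trans)
  then show ?thesis
    using True by (intro image_eqI[of _ _ 0]) auto
next
  case False
  have "norm (f t - f t0) \<le> M * norm (t - t0)"
  proof (rule differentiable_bound[where S="{a..b}" and f'="\<lambda>s h. h *\<^sub>R f' s"])
    fix s assume "s \<in> {a..b}"
    then show "(f has_derivative (\<lambda>h. h *\<^sub>R f' s)) (at s within {a..b})"
      using deriv by (simp add: has_vector_derivative_def)
    show "onorm (\<lambda>h. h *\<^sub>R f' s) \<le> M"
      using bound[OF \<open>s \<in> {a..b}\<close>] by (simp add: onorm_scaleR_left onorm_id)
  qed (use assms in auto)
  then have "(1 / (t - t0)) *\<^sub>R (f t - f t0) \<in> cball 0 M"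
    using False \<open>t0 \<le> t\<close> by (simp add: divide_le_eq)
  moreover have "f t - f t0 = (t - t0) *\<^sub>R ((1 / (t - t0)) *\<^sub>R (f t - f t0))"
    using False by simp
  ultimately show ?thesis
    by (rule rev_image_eqI)
qed

lemma particle_sol_displacement:
  assumes "particle_sol \<alpha> T N x v" "i < N" "\<And>s. s \<in> {0..T} \<Longrightarrow> norm (v i s) \<le> M"
    and "0 \<le> t0" "t0 \<le> t" "t \<le> T"
  shows "x i t - x i t0 \<in> (*\<^sub>R) (t - t0) ` cball 0 M"
proof (rule displacement_in_scaled_cball[where a=0 and b=T and f'="v i"])
  fix s assume "s \<in> {0..T}"
  then show "(x i has_vector_derivative v i s) (at s within {0..T})"
    using assms(1,2) unfolding particle_sol_def by blast
qed (use assms in auto)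

lemma finite_measure_xmarg:
  assumes "finite_measure m" "sets m = sets borel"
  shows "finite_measure (xmarg m)" "sets (xmarg m) = sets borel"
proof -
  have "fst \<in> measurable m borel"
    unfolding measurable_cong_sets[OF assms(2) refl] by (intro borel_measurable_continuous_onI continuous_intros)
  then show "finite_measure (xmarg m)"
    unfolding xmarg_def by (rule finite_measure.finite_measure_distr[OF assms(1)])
  show "sets (xmarg m) = sets borel"
    unfolding xmarg_def by simp
qed

lemma measure_le_measure_closure:
  assumes "finite_measure m" "sets m = sets borel"
  shows "measure m C \<le> measure m (closure C)"
proof (cases "C \<in> sets m")
  case True
  have "closure C \<in> sets m"
    using assms(2) by simp
  then show ?thesis
    by (rule finite_measure.finite_measure_mono[OF assms(1) closure_subset])
qed (simp add: measure_notin_sets)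

lemma empirical_BL_conv_measure_le_sums:
  fixes X Y :: "nat \<Rightarrow> nat \<Rightarrow> 'a::euclidean_space"
  assumes \<rho>: "finite_measure \<rho>" "sets \<rho> = sets borel" and \<sigma>: "finite_measure \<sigma>" "sets \<sigma> = sets borel"
    and X: "empirical_BL_conv N X \<rho>" and Y: "empirical_BL_conv N Y \<sigma>"
    and D: "compact D" "D \<noteq> {}" and moves: "\<And>k i. i < N k \<Longrightarrow> Y k i - X k i \<in> D"
  shows "measure \<rho> C \<le> measure \<sigma> {c + d | c d. c \<in> closure C \<and> d \<in> D}"
    (is "_ \<le> measure \<sigma> ?G")
proof (cases "C = {}")
  case False
  have "?G = (\<Union>c\<in>closure C. \<Union>d\<in>D. {c + d})"
    by blast
  then have "closed ?G"
    using closed_compact_sums[OF closed_closure \<open>compact D\<close>] by simp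
  moreover have "?G \<noteq> {}"
    using False \<open>D \<noteq> {}\<close> closure_subset by blast
  moreover have "z + (Y k i - X k i) \<in> ?G" if "z \<in> closure C" "i < N k" for z k i
    using that moves by blast
  ultimately have "measure \<rho> (closure C) \<le> measure \<sigma> ?G"
    by (intro empirical_BL_conv_measure_transport[OF \<rho> \<sigma> X Y closed_closure])
  then show ?thesis
    using measure_le_measure_closure[OF \<rho>, of C] by linarith
qed simp

theorem mainTheorem10:
  fixes T \<alpha> M :: real
    and \<rho>0 :: "'a::euclidean_space measure" and u0 :: "'a \<Rightarrow> 'a"
    and N :: "nat \<Rightarrow> nat"
    and x v :: "nat \<Rightarrow> nat \<Rightarrow> real \<Rightarrow> 'a"
    and \<mu> :: "real \<Rightarrow> ('a \<times> 'a) measure"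
  assumes T_pos: "T > 0"
    and alpha: "1 \<le> \<alpha>" "\<alpha> \<le> 2"
    and rho0_prob: "prob_space \<rho>0" and rho0_sets: "sets \<rho>0 = sets borel"
    and rho0_cpt: "\<exists>K. compact K \<and> emeasure \<rho>0 (UNIV - K) = 0"
    and u0_meas: "u0 \<in> borel_measurable borel"
    and u0_Linf: "\<exists>C. AE y in \<rho>0. norm (u0 y) \<le> C"
    and N_mono: "strict_mono N"
    and sol: "\<And>k. particle_sol \<alpha> T (N k) (x k) (v k)"
    and init_rho: "\<And>g::'a \<Rightarrow> real. bcont g \<Longrightarrow>
        (\<lambda>k. (1 / real (N k)) * (\<Sum>i<N k. g (x k i 0))) \<longlonglongrightarrow> integral\<^sup>L \<rho>0 g"
    and init_mom: "\<And>g::'a \<Rightarrow> real. bcont g \<Longrightarrow>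
        (\<lambda>k. (1 / real (N k)) *\<^sub>R (\<Sum>i<N k. g (x k i 0) *\<^sub>R v k i 0))
          \<longlonglongrightarrow> integral\<^sup>L \<rho>0 (\<lambda>y. g y *\<^sub>R u0 y)"
    and supp: "\<And>k i t. i < N k \<Longrightarrow> t \<in> {0..T} \<Longrightarrow>
        norm (x k i t) < (T + 1) * M \<and> norm (v k i t) < M"
    and mu_meas: "\<And>t. t \<in> {0..T} \<Longrightarrow> finite_measure (\<mu> t) \<and> sets (\<mu> t) = sets borel"
    and conv_mu: "\<And>g::real \<times> ('a \<times> 'a) \<Rightarrow> real. bcont g \<Longrightarrow>
        (\<lambda>k. LINT t:{0..T}|lborel. (1 / real (N k)) * (\<Sum>i<N k. g (t, (x k i t, v k i t))))
          \<longlonglongrightarrow> (LINT t:{0..T}|lborel. integral\<^sup>L (\<mu> t) (\<lambda>z. g (t, z)))"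
    and conv_mu2: "\<And>g::real \<times> (('a \<times> 'a) \<times> ('a \<times> 'a)) \<Rightarrow> real. bcont g \<Longrightarrow>
        (\<lambda>k. LINT t:{0..T}|lborel. (1 / real (N k))\<^sup>2 *
              (\<Sum>i<N k. \<Sum>j<N k. g (t, ((x k i t, v k i t), (x k j t, v k j t)))))
          \<longlonglongrightarrow> (LINT t:{0..T}|lborel. integral\<^sup>L (\<mu> t \<Otimes>\<^sub>M \<mu> t) (\<lambda>p. g (t, p)))"
    and conv_rho: "\<And>\<epsilon>. \<epsilon> > 0 \<Longrightarrow> \<forall>\<^sub>F k in sequentially. \<forall>t\<in>{0..T}. \<forall>f::'a \<Rightarrow> real. BL1 f \<longrightarrow>
        \<bar>(1 / real (N k)) * (\<Sum>i<N k. f (x k i t)) - integral\<^sup>L (xmarg (\<mu> t)) f\<bar> \<le> \<epsilon>"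
    and conv_energy: "\<exists>A. A \<subseteq> {0..T} \<and> {0..T} - A \<in> null_sets lborel \<and>
        (\<forall>t\<in>A. (\<lambda>k. (1 / real (N k)) * (\<Sum>i<N k. (norm (v k i t))\<^sup>2)) \<longlonglongrightarrow> energy (\<mu> t))"
  shows "\<forall>C t0 t. 0 \<le> t0 \<longrightarrow> t0 \<le> t \<longrightarrow> t \<le> T \<longrightarrow>
           measure (xmarg (\<mu> t)) {c + (t - t0) *\<^sub>R b | c b. c \<in> closure C \<and> b \<in> closure (ball 0 M)}
             \<ge> measure (xmarg (\<mu> t0)) C"
proof (intro allI impI)
  fix C :: "'a set" and t0 t :: real
  assume t: "0 \<le> t0" "t0 \<le> t" "t \<le> T"
  have "0 < N 1"
    using strict_monoD[OF N_mono, of 0 1] by simp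
  with supp T_pos have "norm (v 1 0 0) < M"
    by simp
  then have "0 < M"
    using norm_ge_zero[of "v 1 0 0"] by linarith
  have \<rho>: "finite_measure (xmarg (\<mu> s))" "sets (xmarg (\<mu> s)) = sets borel" if "s \<in> {0..T}" for s
    using finite_measure_xmarg mu_meas[OF that] by auto
  have conv: "empirical_BL_conv N (\<lambda>k i. x k i s) (xmarg (\<mu> s))" if "s \<in> {0..T}" for s
    using conv_rho that unfolding empirical_BL_conv_def by (blast intro: eventually_mono)
  have "x k i t - x k i t0 \<in> (*\<^sub>R) (t - t0) ` cball 0 M" if "i < N k" for k i
    using supp[OF that] t by (intro particle_sol_displacement[OF sol that]) (auto intro: less_imp_le)
  then have "measure (xmarg (\<mu> t0)) C
      \<le> measure (xmarg (\<mu> t)) {c + d | c d. c \<in> closure C \<and> d \<in> (*\<^sub>R) (t - t0) ` cball 0 M}"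
    using \<rho> conv t \<open>0 < M\<close>
    by (intro empirical_BL_conv_measure_le_sums[where N=N]) (auto intro: compact_scaling)
  also have "{c + d | c d. c \<in> closure C \<and> d \<in> (*\<^sub>R) (t - t0) ` cball 0 M}
      = {c + (t - t0) *\<^sub>R b | c b. c \<in> closure C \<and> b \<in> closure (ball 0 M)}"
    using \<open>0 < M\<close> by (simp only: closure_ball) blast
  finally show "measure (xmarg (\<mu> t)) {c + (t - t0) *\<^sub>R b | c b. c \<in> closure C \<and> b \<in> closure (ball 0 M)}
      \<ge> measure (xmarg (\<mu> t0)) C" .
qed

end
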